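(* Let $S$ be the set of rational numbers $m/2^n$ with $m,n$ positive integers and $1\le m\le 2^n-1$, and let $T$ be the set of rational numbers in $(0,1)$. Then: (1) for every $\eta\in S$, $\mathcal{A}'(\eta)=\infty$, i.e. $\lim_{h\to-0}\frac{\mathcal{A}(\eta+h)-\mathcal{A}(\eta)}{h}=\lim_{h\to+0}\frac{\mathcal{A}(\eta+h)-\mathcal{A}(\eta)}{h}=+\infty$; (2) for every $\eta\in T\setminus S$, if $\mathcal{A}$ is differentiable at $\eta$, then $\mathcal{A}'(\eta)=0$.
   Context: Stern's diatomic integers: for integers $n\ge0$, $0\le m\le2^n$, $[2^0:0]=0$, $[2^0:1]=1$, $[2^{n+1}:2m]=[2^n:m]$, $[2^{n+1}:2m+1]=[2^n:m]+[2^n:m+1]$. The assembly function $\mathcal{A}:[0,1)\to[0,\infty)$ is the unique continuous extension of the map $m/2^n\mapsto[2^n:m]/[2^n:2^n-m]$ ($0\le m\le 2^n-1$) on dyadic rationals in $[0,1)$; it is a strictly increasing bijection. *)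

theory Defs
  imports "HOL-Analysis.Analysis"
begin

text \<open>\<open>stern n m\<close> is Stern's diatomic integer $[2^n : m]$. It is meaningful only for
  \<open>m \<le> 2 ^ n\<close>; values outside this range are never used.\<close>

fun stern :: "nat \<Rightarrow> nat \<Rightarrow> nat" where
  "stern 0 m = m"
| "stern (Suc n) m =
     (if even m then stern n (m div 2) else stern n (m div 2) + stern n (m div 2 + 1))"

lemma stern_rec:
  "stern 0 0 = 0" "stern 0 1 = 1"
  "stern (Suc n) (2 * m) = stern n m"
  "stern (Suc n) (2 * m + 1) = stern n m + stern n (m + 1)"
  by simp_all

definition extends_stern_quotient :: "(real \<Rightarrow> real) \<Rightarrow> bool" where
  "extends_stern_quotient F \<longleftrightarrow>
     (\<forall>n m. m \<le> 2 ^ n - 1 \<longrightarrow>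
        F (real m / 2 ^ n) = real (stern n m) / real (stern n (2 ^ n - m)))"

text \<open>Membership in \<^const>\<open>extensional\<close> only pins down the irrelevant values outside
  \<open>[0, 1)\<close>, so that uniqueness on \<open>[0, 1)\<close> becomes uniqueness of a total function.\<close>

definition assembly :: "real \<Rightarrow> real" where
  "assembly = (THE F. F \<in> extensional {0..<1} \<and> continuous_on {0..<1} F \<and>
                      extends_stern_quotient F)"

definition dyadic_unit :: "real set" where
  "dyadic_unit = {real m / 2 ^ n | m n :: nat. 0 < n \<and> 1 \<le> m \<and> m \<le> 2 ^ n - 1}"

definition rational_unit :: "real set" where
  "rational_unit = \<rat> \<inter> {0<..<1}"

end

theory Submission
  imports Defs "HOL-Real_Asymp.Real_Asymp"
begin

text \<open>
  Write \<open>p\<close>, \<open>p'\<close> for \<open>[2\<^sup>n:m]\<close>, \<open>[2\<^sup>n:m+1]\<close> and \<open>q\<close>, \<open>q'\<close> for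
  \<open>[2\<^sup>n:2\<^sup>n-m]\<close>, \<open>[2\<^sup>n:2\<^sup>n-m-1]\<close>. These integers satisfy \<open>p' q - p q' = 1\<close>, and the
  assembly function \<open>A\<close> is self-similar: \<open>A((m + t) / 2\<^sup>n) = (p + p' A(t)) / (q + q' A(t))\<close>.

  At a dyadic point the self-similarity reduces the one-sided difference quotients to the
  behaviour of \<open>A\<close> near the endpoints of \<open>[0, 1)\<close>, where \<open>A\<close> varies only logarithmically:
  \<open>A(t) \<ge> 1 / (1 - log\<^sub>2 t)\<close> and \<open>A(t) \<le> 1 - log\<^sub>2 (1 - t)\<close>.

  A rational point that is not dyadic has an eventually periodic binary expansion, so a dyadic
  affine map carries it to some \<open>t\<close> with \<open>t = (k + t) / 2\<^sup>L\<close>. There the derivative satisfies an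
  equation that forces it to vanish, because \<open>2\<^sup>L\<close> with \<open>L > 0\<close> is never the square of an
  eigenvalue of an integer matrix of determinant 1.
\<close>

section \<open>Stern's diatomic integers\<close>

lemma stern_zero [simp]: "stern n 0 = 0"
  by (induction n) auto

lemma stern_two_power [simp]: "stern n (2 ^ n) = 1"
  by (induction n) auto

lemma stern_pos: "0 < m \<Longrightarrow> 0 < stern n m"
proof (induction n arbitrary: m)
  case (Suc n)
  show ?case
  proof (cases "even m")
    case True
    then have "0 < m div 2" using Suc.prems by auto
    then show ?thesis using Suc.IH True by simp
  next
    case False
    then show ?thesis using Suc.IH[of "m div 2 + 1"] by simp
  qed
qed simp

text \<open>Refining the gap between two neighbours is linear in them: \<open>stern i j\<close> is
  the coefficient of the right one, and its mirror image \<open>stern i (2 ^ i - j)\<close> that of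
  the left one.\<close>

lemma stern_concat:
  "j \<le> 2 ^ i \<Longrightarrow>
    stern (n + i) (2 ^ i * m + j) = stern n m * stern i (2 ^ i - j) + stern n (Suc m) * stern i j"
proof (induction i arbitrary: j)
  case 0
  then consider "j = 0" | "j = 1" by fastforce
  then show ?case by cases auto
next
  case (Suc i)
  show ?case
  proof (cases "even j")
    case True
    then obtain k where j: "j = 2 * k" by (elim evenE)
    have "2 ^ Suc i * m + j = 2 * (2 ^ i * m + k)" "2 ^ Suc i - j = 2 * (2 ^ i - k)"
      using j by (simp_all add: algebra_simps)
    then show ?thesis
      using Suc.IH[of k] Suc.prems j by simp
  next
    case False
    then obtain k where j: "j = 2 * k + 1" by (elim oddE)
    have k: "Suc k \<le> 2 ^ i" using Suc.prems j by simp
    have eq: "2 ^ Suc i * m + j = 2 * (2 ^ i * m + k) + 1"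
      "2 ^ Suc i - j = 2 * (2 ^ i - Suc k) + 1" "2 ^ i - Suc k + 1 = 2 ^ i - k"
      using j k by (simp_all add: algebra_simps)
    have "stern (n + Suc i) (2 ^ Suc i * m + j)
        = stern (n + i) (2 ^ i * m + k) + stern (n + i) (2 ^ i * m + Suc k)"
      unfolding eq add_Suc_right stern_rec by simp
    moreover have "stern (Suc i) (2 ^ Suc i - j) = stern i (2 ^ i - Suc k) + stern i (2 ^ i - k)"
      unfolding eq stern_rec by (simp add: eq(3))
    moreover have "stern (Suc i) j = stern i k + stern i (Suc k)"
      unfolding j stern_rec by simp
    ultimately show ?thesis
      using Suc.IH[of k] Suc.IH[of "Suc k"] k by (simp add: algebra_simps)
  qed
qed

text \<open>Passing to the next row keeps one of the two neighbouring columns and replaces the other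
  by their sum, which preserves the determinant. The additive form avoids truncated
  subtraction.\<close>

lemma stern_det:
  "m < 2 ^ n \<Longrightarrow>
    stern n (Suc m) * stern n (2 ^ n - m) = stern n m * stern n (2 ^ n - Suc m) + 1"
proof (induction n arbitrary: m)
  case (Suc n)
  define k where "k = m div 2"
  have k: "k < 2 ^ n" using Suc.prems k_def by auto
  note IH = Suc.IH[OF k]
  have odd_rec: "stern (Suc n) (2 * (2 ^ n - Suc k) + 1) = stern n (2 ^ n - Suc k) + stern n (2 ^ n - k)"
    using k unfolding stern_rec by (simp add: Suc_diff_Suc)
  show ?case
  proof (cases "even m")
    case True
    have eq: "m = 2 * k" "Suc m = 2 * k + 1" "2 ^ Suc n - m = 2 * (2 ^ n - k)"
      "2 ^ Suc n - Suc m = 2 * (2 ^ n - Suc k) + 1"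
      using True k by (auto simp: k_def)
    show ?thesis
      unfolding eq(4) odd_rec unfolding eq(3) unfolding eq(2) unfolding eq(1) stern_rec
      using IH by (simp add: algebra_simps)
  next
    case False
    have "m = 2 * k + 1" using False by (simp add: k_def)
    then have eq: "m = 2 * k + 1" "Suc m = 2 * (Suc k)"
      "2 ^ Suc n - m = 2 * (2 ^ n - Suc k) + 1" "2 ^ Suc n - Suc m = 2 * (2 ^ n - Suc k)"
      using k by auto
    show ?thesis
      unfolding eq(4) unfolding eq(3) odd_rec unfolding eq(2) unfolding eq(1) stern_rec
      using IH by (simp add: algebra_simps)
  qed
qed simp

lemma stern_det_real:
  assumes "m < 2 ^ n"
  shows "real (stern n (Suc m)) * real (stern n (2 ^ n - m))
       = real (stern n m) * real (stern n (2 ^ n - Suc m)) + 1"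
  using stern_det[OF assms] by (metis of_nat_1 of_nat_add of_nat_mult)

section \<open>Existence and uniqueness of the assembly function\<close>

text \<open>Numerator plus denominator of the quotient: it obeys Stern's recursion with both
  starting values equal to 1.\<close>

definition stern_sum :: "nat \<Rightarrow> nat \<Rightarrow> nat" where
  "stern_sum n m = stern n m + stern n (2 ^ n - m)"

text \<open>The bounded substitute \<open>A / (1 + A)\<close> for the quotient \<open>A\<close>: unlike \<open>A\<close> it is uniformly
  continuous.\<close>

definition stern_frac :: "nat \<Rightarrow> nat \<Rightarrow> real" where
  "stern_frac n m = real (stern n m) / real (stern_sum n m)"

lemma stern_sum_even: "stern_sum (Suc n) (2 * m) = stern_sum n m"
proof -
  have "2 ^ Suc n - 2 * m = 2 * (2 ^ n - m)" by simp
  then show ?thesis unfolding stern_sum_def by (simp only: stern_rec)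
qed

lemma stern_sum_odd:
  assumes "m < 2 ^ n"
  shows "stern_sum (Suc n) (2 * m + 1) = stern_sum n m + stern_sum n (Suc m)"
proof -
  have "2 ^ Suc n - (2 * m + 1) = 2 * (2 ^ n - Suc m) + 1" "2 ^ n - Suc m + 1 = 2 ^ n - m"
    using assms by auto
  then show ?thesis unfolding stern_sum_def by (simp only: stern_rec) simp
qed

lemma stern_sum_pos: "0 < stern_sum n m"
proof (cases "m = 0")
  case False
  then show ?thesis using stern_pos[of m n] by (simp add: stern_sum_def)
qed (simp add: stern_sum_def)

text \<open>Refinement turns a product \<open>s * s'\<close> of neighbours into
  \<open>s * (s + s')\<close> or \<open>(s + s') * s'\<close>, so it grows by at least 1 with each
  row.\<close>

lemma stern_sum_mult_ge:
  "m < 2 ^ n \<Longrightarrow> Suc n \<le> stern_sum n m * stern_sum n (Suc m)"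
proof (induction n arbitrary: m)
  case (Suc n)
  define k where "k = m div 2"
  have k: "k < 2 ^ n" using Suc.prems k_def by auto
  note IH = Suc.IH[OF k]
  have sq: "1 \<le> stern_sum n l * stern_sum n l" for l
    using stern_sum_pos[of n l] by simp
  show ?case
  proof (cases "even m")
    case True
    then have eq: "m = 2 * k" "Suc m = 2 * k + 1" by (auto simp: k_def)
    show ?thesis
      unfolding eq(2) stern_sum_odd[OF k] unfolding eq(1) stern_sum_even
      using add_mono[OF IH sq[of k]] by (simp add: algebra_simps)
  next
    case False
    then have eq: "m = 2 * k + 1" "Suc m = 2 * Suc k" by (auto simp: k_def)
    show ?thesis
      unfolding eq(2) stern_sum_even unfolding eq(1) stern_sum_odd[OF k]
      using add_mono[OF IH sq[of "Suc k"]] by (simp add: algebra_simps)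
  qed
qed (simp add: stern_sum_def)

text \<open>Adding one row of the 2-by-2 matrix to the other keeps its determinant 1, and this
  determinant is the numerator of the difference.\<close>

lemma stern_frac_gap:
  assumes "m < 2 ^ n"
  shows "stern_frac n (Suc m) - stern_frac n m
       = 1 / (real (stern_sum n m) * real (stern_sum n (Suc m)))"
proof -
  have "real (stern n (Suc m)) * real (stern_sum n m)
      - real (stern n m) * real (stern_sum n (Suc m)) = 1"
    using stern_det_real[OF assms] by (simp add: stern_sum_def algebra_simps)
  then show ?thesis
    using stern_sum_pos[of n m] stern_sum_pos[of n "Suc m"]
    by (simp add: stern_frac_def diff_frac_eq mult.commute)
qed

lemma stern_frac_gap_bounds:
  assumes "m < 2 ^ n"
  shows "stern_frac n m \<le> stern_frac n (Suc m)"
    and "stern_frac n (Suc m) - stern_frac n m \<le> 1 / real (Suc n)"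
proof -
  show "stern_frac n m \<le> stern_frac n (Suc m)"
    using stern_frac_gap[OF assms] by (smt (verit) divide_nonneg_nonneg mult_nonneg_nonneg of_nat_0_le_iff)
  have "real (Suc n) \<le> real (stern_sum n m) * real (stern_sum n (Suc m))"
    using stern_sum_mult_ge[OF assms] by (metis of_nat_le_iff of_nat_mult)
  then show "stern_frac n (Suc m) - stern_frac n m \<le> 1 / real (Suc n)"
    unfolding stern_frac_gap[OF assms] by (intro divide_left_mono) auto
qed

lemma stern_frac_even: "stern_frac (Suc n) (2 * m) = stern_frac n m"
  unfolding stern_frac_def stern_sum_even stern_rec ..

lemma stern_frac_odd_bounds:
  assumes "m < 2 ^ n"
  shows "stern_frac n m \<le> stern_frac (Suc n) (2 * m + 1)"
    and "stern_frac (Suc n) (2 * m + 1) \<le> stern_frac n (Suc m)"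
proof -
  have "stern_frac (Suc n) (2 * m) \<le> stern_frac (Suc n) (Suc (2 * m))"
    using assms by (intro stern_frac_gap_bounds) auto
  then show "stern_frac n m \<le> stern_frac (Suc n) (2 * m + 1)"
    by (simp add: stern_frac_even)
  have "stern_frac (Suc n) (2 * m + 1) \<le> stern_frac (Suc n) (Suc (2 * m + 1))"
    using assms by (intro stern_frac_gap_bounds) auto
  moreover have "Suc (2 * m + 1) = 2 * Suc m" by simp
  ultimately show "stern_frac (Suc n) (2 * m + 1) \<le> stern_frac n (Suc m)"
    by (simp only: stern_frac_even)
qed

lemma stern_frac_shift: "stern_frac (n + k) (2 ^ k * m) = stern_frac n m"
proof (induction k)
  case (Suc k)
  have "2 ^ Suc k * m = 2 * (2 ^ k * m)" by simp
  then show ?case using Suc stern_frac_even[of "n + k"] by (simp only: add_Suc_right)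
qed simp

lemma stern_frac_less_one: "m < 2 ^ n \<Longrightarrow> stern_frac n m < 1"
  using stern_pos[of "2 ^ n - m" n] by (simp add: stern_frac_def stern_sum_def)

section \<open>Binary truncations and density of dyadic points\<close>

definition dyadic_floor :: "nat \<Rightarrow> real \<Rightarrow> nat" where
  "dyadic_floor n x = nat \<lfloor>2 ^ n * x\<rfloor>"

lemma dyadic_floor_bounds:
  assumes "0 \<le> x"
  shows "real (dyadic_floor n x) \<le> 2 ^ n * x" "2 ^ n * x < real (dyadic_floor n x) + 1"
proof -
  have "0 \<le> \<lfloor>2 ^ n * x\<rfloor>" using assms by simp
  then have "real (dyadic_floor n x) = of_int \<lfloor>2 ^ n * x\<rfloor>"
    by (simp add: dyadic_floor_def)
  then show "real (dyadic_floor n x) \<le> 2 ^ n * x" "2 ^ n * x < real (dyadic_floor n x) + 1"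
    by linarith+
qed

lemma dyadic_floor_less:
  assumes "0 \<le> x" "x < 1"
  shows "dyadic_floor n x < 2 ^ n"
proof -
  have "real (dyadic_floor n x) < 2 ^ n"
    using dyadic_floor_bounds(1)[OF assms(1), of n] assms(2)
    by (smt (verit) mult_less_cancel_left2 zero_less_power)
  then show ?thesis by simp
qed

lemma dyadic_floor_Suc:
  assumes "0 \<le> x"
  shows "dyadic_floor (Suc n) x = 2 * dyadic_floor n x \<or>
         dyadic_floor (Suc n) x = 2 * dyadic_floor n x + 1"
proof -
  have "real (dyadic_floor (Suc n) x) < real (2 * dyadic_floor n x + 2)"
       "real (2 * dyadic_floor n x) < real (dyadic_floor (Suc n) x + 1)"
    using dyadic_floor_bounds[OF assms, of n] dyadic_floor_bounds[OF assms, of "Suc n"] by simp_all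
  then show ?thesis unfolding of_nat_less_iff by linarith
qed

lemma dyadic_floor_tendsto:
  assumes "0 \<le> x"
  shows "(\<lambda>n. real (dyadic_floor n x) / 2 ^ n) \<longlonglongrightarrow> x"
proof (rule tendsto_sandwich)
  show "\<forall>\<^sub>F n in sequentially. x - 1 / 2 ^ n \<le> real (dyadic_floor n x) / 2 ^ n"
  proof (intro always_eventually allI)
    fix n
    have "x < (real (dyadic_floor n x) + 1) / 2 ^ n"
      using dyadic_floor_bounds(2)[OF assms, of n] by (simp add: pos_less_divide_eq mult.commute)
    then show "x - 1 / 2 ^ n \<le> real (dyadic_floor n x) / 2 ^ n"
      by (simp add: add_divide_distrib)
  qed
  show "\<forall>\<^sub>F n in sequentially. real (dyadic_floor n x) / 2 ^ n \<le> x"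
    using dyadic_floor_bounds(1)[OF assms] by (intro always_eventually allI) (simp add: field_simps)
  show "(\<lambda>n. x - 1 / 2 ^ n) \<longlonglongrightarrow> x"
    by real_asymp
qed simp

text \<open>Truncations approximate \<open>x\<close> from below, so they stay in
  \<open>[0, 1)\<close>, where continuity is available.\<close>

lemma eq_on_dyadics_imp_eq:
  fixes f g :: "real \<Rightarrow> real"
  assumes cont: "continuous_on {0..<1} f" "continuous_on {0..<1} g"
    and eq: "\<And>n m. m < 2 ^ n \<Longrightarrow> f (real m / 2 ^ n) = g (real m / 2 ^ n)"
    and x: "0 \<le> x" "x < 1"
  shows "f x = g x"
proof -
  let ?d = "\<lambda>n. real (dyadic_floor n x) / 2 ^ n"
  have "real (dyadic_floor n x) < 2 ^ n" for n
    using dyadic_floor_less[OF x, of n] by simp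
  then have ev: "\<forall>\<^sub>F n in sequentially. ?d n \<in> {0..<1}" by simp
  have "(\<lambda>n. f (?d n)) \<longlonglongrightarrow> f x" "(\<lambda>n. g (?d n)) \<longlonglongrightarrow> g x"
    using continuous_on_tendsto_compose[OF _ dyadic_floor_tendsto[OF x(1)] _ ev] cont x by auto
  moreover have "(\<lambda>n. f (?d n)) = (\<lambda>n. g (?d n))"
    using eq dyadic_floor_less[OF x] by auto
  ultimately show ?thesis using LIMSEQ_unique by metis
qed

section \<open>Continuous extension of the bounded quotient\<close>

definition stern_limit :: "real \<Rightarrow> real" where
  "stern_limit x = lim (\<lambda>n. stern_frac n (dyadic_floor n x))"

text \<open>Nested intervals: values at the left ends of the dyadic cells around \<open>x\<close>
  increase, those at the right ends decrease, and the gap is at most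
  \<open>1 / (n + 1)\<close>.\<close>

lemma stern_limit_bounds:
  assumes x: "0 \<le> x" "x < 1"
  shows "(\<lambda>n. stern_frac n (dyadic_floor n x)) \<longlonglongrightarrow> stern_limit x"
    and "stern_frac n (dyadic_floor n x) \<le> stern_limit x"
    and "stern_limit x \<le> stern_frac n (Suc (dyadic_floor n x))"
proof -
  let ?b = "\<lambda>n. stern_frac n (dyadic_floor n x)"
  let ?c = "\<lambda>n. stern_frac n (Suc (dyadic_floor n x))"
  note less = dyadic_floor_less[OF x]
  have b: "?b n \<le> ?b (Suc n)" for n
    using dyadic_floor_Suc[OF x(1), of n] stern_frac_odd_bounds(1)[OF less, of n]
      stern_frac_even[of n "dyadic_floor n x"] by auto
  have c: "?c (Suc n) \<le> ?c n" for n
    using dyadic_floor_Suc[OF x(1), of n]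
  proof
    assume "dyadic_floor (Suc n) x = 2 * dyadic_floor n x"
    then show ?thesis using stern_frac_odd_bounds(2)[OF less, of n] by simp
  next
    assume "dyadic_floor (Suc n) x = 2 * dyadic_floor n x + 1"
    then have "Suc (dyadic_floor (Suc n) x) = 2 * Suc (dyadic_floor n x)" by simp
    then show ?thesis by (simp only: stern_frac_even)
  qed
  have lim0: "(\<lambda>n. ?b n - ?c n) \<longlonglongrightarrow> 0"
  proof (rule tendsto_sandwich)
    show "\<forall>\<^sub>F n in sequentially. - (1 / real (Suc n)) \<le> ?b n - ?c n"
      using stern_frac_gap_bounds(2)[OF less] by (intro always_eventually allI) (smt (verit))
    show "\<forall>\<^sub>F n in sequentially. ?b n - ?c n \<le> 0"
      using stern_frac_gap_bounds(1)[OF less] by simp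
    show "(\<lambda>n. - (1 / real (Suc n))) \<longlonglongrightarrow> 0" by real_asymp
  qed simp
  from nested_sequence_unique[of ?b ?c] b c stern_frac_gap_bounds(1)[OF less] lim0
  obtain l where l: "\<And>n. ?b n \<le> l" "?b \<longlonglongrightarrow> l" "\<And>n. l \<le> ?c n" by blast
  have "stern_limit x = l"
    unfolding stern_limit_def using l(2) by (rule limI)
  then show "?b \<longlonglongrightarrow> stern_limit x" "?b n \<le> stern_limit x" "stern_limit x \<le> ?c n"
    using l by auto
qed

lemma stern_limit_dyadic:
  assumes "m < 2 ^ n"
  shows "stern_limit (real m / 2 ^ n) = stern_frac n m"
proof -
  let ?x = "real m / 2 ^ n"
  have "real m < 2 ^ n" using assms by simp
  then have x: "0 \<le> ?x" "?x < 1" by simp_all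
  have "dyadic_floor (n + k) ?x = 2 ^ k * m" for k
  proof -
    have "2 ^ (n + k) * ?x = of_int (int (2 ^ k * m))" by (simp add: power_add)
    then show ?thesis unfolding dyadic_floor_def by (simp only: floor_of_int nat_int)
  qed
  then have "stern_frac (k + n) (dyadic_floor (k + n) ?x) = stern_frac n m" for k
    using stern_frac_shift[of n k m] by (simp add: add.commute)
  then show ?thesis
    using LIMSEQ_ignore_initial_segment[OF stern_limit_bounds(1)[OF x], of n]
    by (simp add: LIMSEQ_const_iff)
qed

text \<open>For large \<open>n\<close> the right end of the cell containing \<open>x\<close> is
  still below 1, where \<open>stern_frac\<close> is below 1. This makes division by
  \<open>1 - stern_limit x\<close> legitimate.\<close>

lemma stern_limit_less_one:
  assumes x: "0 \<le> x" "x < 1"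
  shows "stern_limit x < 1"
proof -
  obtain n where n: "1 / (1 - x) < 2 ^ n"
    using real_arch_pow[of 2 "1 / (1 - x)"] by auto
  have "real (dyadic_floor n x) + 1 < 2 ^ n"
    using n x dyadic_floor_bounds(1)[OF x(1), of n] by (simp add: field_simps)
  then have "real (Suc (dyadic_floor n x)) < real (2 ^ n)" by simp
  then have "Suc (dyadic_floor n x) < 2 ^ n" unfolding of_nat_less_iff .
  then show ?thesis
    using stern_limit_bounds(3)[OF x, of n] stern_frac_less_one by fastforce
qed

text \<open>Points closer than \<open>1 / 2 ^ n\<close> lie in the same or in adjacent cells, so at
  most two gaps separate their values.\<close>

lemma stern_limit_modulus:
  assumes x: "0 \<le> x" "x < 1" and y: "0 \<le> y" "y < 1" and xy: "\<bar>x - y\<bar> < 1 / 2 ^ n"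
  shows "\<bar>stern_limit x - stern_limit y\<bar> \<le> 2 / real (Suc n)"
proof -
  let ?i = "dyadic_floor n x" and ?j = "dyadic_floor n y"
  have "\<bar>2 ^ n * x - 2 ^ n * y\<bar> < 1"
    using xy by (simp add: abs_less_iff field_simps)
  then have "real ?i < real (?j + 2)" "real ?j < real (?i + 2)"
    using dyadic_floor_bounds[OF x(1), of n] dyadic_floor_bounds[OF y(1), of n] by simp_all
  then consider "?i = ?j" | "?i = Suc ?j" | "?j = Suc ?i"
    unfolding of_nat_less_iff by linarith
  then show ?thesis
    using stern_limit_bounds(2,3)[OF x, of n] stern_limit_bounds(2,3)[OF y, of n]
      stern_frac_gap_bounds[OF dyadic_floor_less[OF x], of n]
      stern_frac_gap_bounds[OF dyadic_floor_less[OF y], of n]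
    by cases (simp_all add: abs_le_iff)
qed

lemma continuous_on_stern_limit: "continuous_on {0..<1} stern_limit"
  unfolding continuous_on_iff
proof (intro ballI allI impI)
  fix x e :: real assume x: "x \<in> {0..<1}" and e: "0 < e"
  obtain n where "2 / e < real n" using reals_Archimedean2 by blast
  then have n: "2 / real (Suc n) < e" using e by (simp add: field_simps)
  show "\<exists>d>0. \<forall>x'\<in>{0..<1}. dist x' x < d \<longrightarrow> dist (stern_limit x') (stern_limit x) < e"
  proof (intro exI[of _ "1 / 2 ^ n"] conjI ballI impI)
    fix y assume y: "y \<in> {0..<1::real}" "dist y x < 1 / 2 ^ n"
    then show "dist (stern_limit y) (stern_limit x) < e"
      using stern_limit_modulus[of y x n] x n by (simp add: dist_real_def)
  qed simp
qed

section \<open>The assembly function is well defined\<close>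

lemma extends_stern_quotientD:
  assumes "extends_stern_quotient F" "m < 2 ^ n"
  shows "F (real m / 2 ^ n) = real (stern n m) / real (stern n (2 ^ n - m))"
  using assms unfolding extends_stern_quotient_def by (metis Suc_leI Suc_pred' le_Suc_eq less_Suc_eq_le pos2 zero_less_power)

lemma assembly_spec:
  "continuous_on {0..<1} assembly" "extends_stern_quotient assembly"
proof -
  let ?P = "\<lambda>F. F \<in> extensional {0..<1::real} \<and> continuous_on {0..<1} F \<and> extends_stern_quotient F"
  \<comment> \<open>The map \<open>y / (1 - y)\<close> undoes the substitution
    \<open>A / (1 + A)\<close>.\<close>
  define G where "G = restrict (\<lambda>x. stern_limit x / (1 - stern_limit x)) {0..<1}"
  have "continuous_on {0..<1} (\<lambda>x. stern_limit x / (1 - stern_limit x))"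
    using stern_limit_less_one by (intro continuous_intros continuous_on_stern_limit) fastforce
  then have "continuous_on {0..<1} G"
    by (rule continuous_on_eq) (simp add: G_def)
  moreover have "extends_stern_quotient G"
    unfolding extends_stern_quotient_def
  proof (intro allI impI)
    fix n m :: nat assume "m \<le> 2 ^ n - 1"
    then have m: "m < 2 ^ n" by (metis Suc_pred' le_imp_less_Suc pos2 zero_less_power)
    then have "real m < 2 ^ n" by simp
    then have "G (real m / 2 ^ n) = stern_frac n m / (1 - stern_frac n m)"
      using m by (simp add: G_def stern_limit_dyadic)
    also have "\<dots> = real (stern n m) / real (stern n (2 ^ n - m))"
    proof -
      have "1 - stern_frac n m = real (stern n (2 ^ n - m)) / real (stern_sum n m)"
      proof -
        have "real (stern n (2 ^ n - m)) = real (stern_sum n m) - real (stern n m)"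
          by (simp add: stern_sum_def)
        then show ?thesis
          using stern_sum_pos[of n m] by (simp add: stern_frac_def diff_divide_distrib)
      qed
      then show ?thesis using stern_sum_pos[of n m] by (simp add: stern_frac_def)
    qed
    finally show "G (real m / 2 ^ n) = real (stern n m) / real (stern n (2 ^ n - m))" .
  qed
  ultimately have G: "?P G" by (simp add: G_def)
  \<comment> \<open>Uniqueness, which the definite description requires: candidates agree at dyadic
    points, hence on \<open>[0, 1)\<close>, and outside by extensionality.\<close>
  have "H = G" if H: "?P H" for H
  proof (rule extensionalityI[of _ "{0..<1}"])
    fix x :: real assume "x \<in> {0..<1}"
    then have "0 \<le> x" "x < 1" by simp_all
    with _ _ _ show "H x = G x"
    proof (rule eq_on_dyadics_imp_eq)
      show "continuous_on {0..<1} H" "continuous_on {0..<1} G" using G H by simp_all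
      fix n m :: nat assume "m < 2 ^ n"
      then show "H (real m / 2 ^ n) = G (real m / 2 ^ n)"
        using extends_stern_quotientD[of G m n] extends_stern_quotientD[of H m n] G H by simp
    qed
  qed (use G H in simp_all)
  with G have "?P assembly" unfolding assembly_def by (rule theI)
  then show "continuous_on {0..<1} assembly" "extends_stern_quotient assembly" by auto
qed

lemmas assembly_dyadic = extends_stern_quotientD[OF assembly_spec(2)]

section \<open>Self-similarity\<close>

lemma assembly_nonneg:
  assumes "0 \<le> x" "x < 1"
  shows "0 \<le> assembly x"
proof -
  have "\<bar>assembly x\<bar> = assembly x"
    by (rule eq_on_dyadics_imp_eq[of "\<lambda>x. \<bar>assembly x\<bar>"])
      (use assms in \<open>auto intro!: continuous_intros assembly_spec simp: assembly_dyadic\<close>)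
  then show ?thesis by linarith
qed

text \<open>Both sides are continuous in \<open>t\<close>, so dyadic \<open>t\<close> suffice; there
  the claim is \<open>stern_concat\<close> applied to numerator and denominator.\<close>

lemma assembly_self_similar:
  assumes m: "m < 2 ^ n" and t: "0 \<le> t" "t < 1"
  shows "assembly ((real m + t) / 2 ^ n) =
    (real (stern n m) + real (stern n (Suc m)) * assembly t) /
    (real (stern n (2 ^ n - m)) + real (stern n (2 ^ n - Suc m)) * assembly t)"
proof (rule eq_on_dyadics_imp_eq[OF _ _ _ t,
      of "\<lambda>t. assembly ((real m + t) / 2 ^ n)"
         "\<lambda>t. (real (stern n m) + real (stern n (Suc m)) * assembly t) /
              (real (stern n (2 ^ n - m)) + real (stern n (2 ^ n - Suc m)) * assembly t)"])
  have "real (Suc m) \<le> real (2 ^ n)" using m unfolding of_nat_le_iff by simp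
  then have "(real m + t) / 2 ^ n \<in> {0..<1}" if "t \<in> {0..<1}" for t
    using that by simp
  then show "continuous_on {0..<1} (\<lambda>t. assembly ((real m + t) / 2 ^ n))"
    by (intro continuous_on_compose2[OF assembly_spec(1)] continuous_intros) auto
  have q: "0 < real (stern n (2 ^ n - m))" using m stern_pos by simp
  have "real (stern n (2 ^ n - m)) + real (stern n (2 ^ n - Suc m)) * assembly t \<noteq> 0"
    if "t \<in> {0..<1}" for t
    using q assembly_nonneg[of t] that by (simp add: add_pos_nonneg less_imp_neq[symmetric])
  then show "continuous_on {0..<1} (\<lambda>t. (real (stern n m) + real (stern n (Suc m)) * assembly t) /
              (real (stern n (2 ^ n - m)) + real (stern n (2 ^ n - Suc m)) * assembly t))"
    by (intro continuous_intros assembly_spec) auto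
  fix i j :: nat assume j: "j < 2 ^ i"
  have le: "2 ^ i * m + j < 2 ^ (n + i)"
  proof -
    have "2 ^ i * m + j < 2 ^ i * Suc m" using j by simp
    also have "\<dots> \<le> 2 ^ i * 2 ^ n" using m by (intro mult_left_mono) auto
    finally show ?thesis by (simp add: power_add mult.commute)
  qed
  \<comment> \<open>Reflection sends offset \<open>j\<close> in cell \<open>m\<close> to offset
    \<open>2 ^ i - j\<close> in cell \<open>2 ^ n - Suc m\<close>, so the denominator can be
    concatenated too.\<close>
  have split: "2 ^ (n + i) - (2 ^ i * m + j) = 2 ^ i * (2 ^ n - Suc m) + (2 ^ i - j)"
  proof -
    obtain d where d: "2 ^ n = Suc m + d" using m by (metis Suc_leI le_Suc_ex)
    obtain e where e: "2 ^ i = j + e" using j by (metis less_imp_le_nat le_Suc_ex)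
    have "2 ^ (n + i) = 2 ^ i * m + j + (2 ^ i * d + e)"
      by (simp add: power_add d e algebra_simps)
    then show ?thesis using d e by simp
  qed
  have num: "stern (n + i) (2 ^ i * m + j) =
      stern n m * stern i (2 ^ i - j) + stern n (Suc m) * stern i j"
    using j by (intro stern_concat) simp
  have "Suc (2 ^ n - Suc m) = 2 ^ n - m" "2 ^ i - (2 ^ i - j) = j" using m j by simp_all
  then have den: "stern (n + i) (2 ^ (n + i) - (2 ^ i * m + j)) =
      stern n (2 ^ n - Suc m) * stern i j + stern n (2 ^ n - m) * stern i (2 ^ i - j)"
    unfolding split using stern_concat[of "2 ^ i - j" i n "2 ^ n - Suc m"] by simp
  have pos: "0 < real (stern i (2 ^ i - j))" using j stern_pos by simp
  have "(real m + real j / 2 ^ i) / 2 ^ n = real (2 ^ i * m + j) / 2 ^ (n + i)"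
    by (simp add: power_add field_simps)
  then have "assembly ((real m + real j / 2 ^ i) / 2 ^ n) =
      real (stern (n + i) (2 ^ i * m + j)) / real (stern (n + i) (2 ^ (n + i) - (2 ^ i * m + j)))"
    using assembly_dyadic[OF le] by simp
  also have "\<dots> = (real (stern n m) + real (stern n (Suc m)) * assembly (real j / 2 ^ i)) /
      (real (stern n (2 ^ n - m)) + real (stern n (2 ^ n - Suc m)) * assembly (real j / 2 ^ i))"
  proof -
    have combine: "(a + b * (u / v)) / (c + d * (u / v)) = (a * v + b * u) / (d * u + c * v)"
      if "0 < v" for a b c d u v :: real
    proof -
      have "(a * v + b * u) / v = a + b * (u / v)" "(d * u + c * v) / v = c + d * (u / v)"
        using that by (simp_all add: add_divide_distrib)
      then show ?thesis using that by (metis divide_divide_eq_right nonzero_mult_div_cancel_right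
            less_irrefl times_divide_eq_left divide_divide_eq_left mult.commute)
    qed
    show ?thesis
      unfolding num den assembly_dyadic[OF j] combine[OF pos] by (simp only: of_nat_add of_nat_mult)
  qed
  finally show "assembly ((real m + real j / 2 ^ i) / 2 ^ n) = \<dots>" .
qed

lemma assembly_half:
  assumes "0 \<le> t" "t < 1"
  shows "assembly (t / 2) = assembly t / (1 + assembly t)"
  using assembly_self_similar[of 0 1 t] assms by simp

lemma assembly_upper_half:
  assumes "0 \<le> t" "t < 1"
  shows "assembly ((1 + t) / 2) = 1 + assembly t"
  using assembly_self_similar[of 1 1 t] assms by simp

section \<open>Logarithmic bounds near the end points\<close>

text \<open>Halving the argument adds 1 to \<open>1 / A\<close>, and \<open>A\<close> is at least 1
  on the upper half. The case \<open>k = 0\<close> is vacuous.\<close>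

lemma assembly_ge_inverse:
  "1 / 2 ^ k \<le> t \<Longrightarrow> t < 1 \<Longrightarrow> 1 \<le> real k * assembly t"
proof (induction k arbitrary: t)
  case (Suc k)
  show ?case
  proof (cases "t < 1 / 2")
    case True
    have "0 \<le> t" using order.trans[OF _ Suc.prems(1), of 0] by simp
    moreover have "1 / 2 ^ k = 2 * (1 / 2 ^ Suc k :: real)" by simp
    ultimately have t: "0 \<le> 2 * t" "2 * t < 1" "1 / 2 ^ k \<le> 2 * t"
      using Suc.prems True by linarith+
    have "1 + assembly (2 * t) \<le> real (Suc k) * assembly (2 * t)"
      using Suc.IH[OF t(3,2)] by (simp add: algebra_simps)
    then show ?thesis
      using assembly_half[OF t(1,2)] assembly_nonneg[OF t(1,2)] by (simp add: pos_le_divide_eq)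
  next
    case False
    then have t: "0 \<le> 2 * t - 1" "2 * t - 1 < 1" using Suc.prems by auto
    have "1 \<le> assembly t"
      using assembly_upper_half[OF t] assembly_nonneg[OF t] by simp
    then show ?thesis
      using mult_mono[of 1 "real (Suc k)" 1 "assembly t"] by simp
  qed
qed simp

text \<open>Halving the distance to 1 adds 1 to \<open>A\<close>, and \<open>A\<close> is at most 1
  on the lower half. The case \<open>k = 0\<close> is vacuous.\<close>

lemma assembly_le:
  "0 \<le> t \<Longrightarrow> t < 1 - 1 / 2 ^ k \<Longrightarrow> assembly t \<le> real k"
proof (induction k arbitrary: t)
  case (Suc k)
  show ?case
  proof (cases "t < 1 / 2")
    case True
    then have t: "0 \<le> 2 * t" "2 * t < 1" using Suc.prems by auto
    have "assembly t \<le> 1"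
      using assembly_half[OF t] assembly_nonneg[OF t] by simp
    then show ?thesis by simp
  next
    case False
    have t: "0 \<le> 2 * t - 1" "2 * t - 1 < 1 - 1 / 2 ^ k"
      using Suc.prems False by (simp_all add: field_simps)
    have "2 * t - 1 < 1" using t(2) by (smt (verit) zero_less_divide_1_iff zero_less_power)
    then show ?thesis
      using assembly_upper_half[OF t(1)] Suc.IH[OF t] by simp
  qed
qed simp

lemma assembly_ge_log:
  assumes "0 < t" "t < 1"
  shows "1 \<le> (1 - log 2 t) * assembly t"
proof -
  define k where "k = nat \<lceil>- log 2 t\<rceil>"
  have log: "log 2 t < 0" using assms by simp
  then have k: "- log 2 t \<le> real k" "real k \<le> 1 - log 2 t"
    unfolding k_def by linarith+
  have "2 powr (- real k) \<le> 2 powr (log 2 t)" using k(1) by (intro powr_mono) auto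
  then have "1 / 2 ^ k \<le> t"
    using assms by (simp add: powr_minus powr_realpow divide_inverse)
  then have "1 \<le> real k * assembly t" using assms assembly_ge_inverse by simp
  also have "\<dots> \<le> (1 - log 2 t) * assembly t"
    using k assms assembly_nonneg by (intro mult_right_mono) auto
  finally show ?thesis .
qed

lemma assembly_le_log:
  assumes "0 < t" "t < 1"
  shows "assembly t \<le> 1 - log 2 (1 - t)"
proof -
  \<comment> \<open>Floor plus one rather than ceiling: \<open>assembly_le\<close> needs the strict
    inequality \<open>1 / 2 ^ k < 1 - t\<close>.\<close>
  define k where "k = nat (\<lfloor>- log 2 (1 - t)\<rfloor> + 1)"
  have log: "log 2 (1 - t) < 0" using assms by simp
  then have k: "- log 2 (1 - t) < real k" "real k \<le> 1 - log 2 (1 - t)"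
    unfolding k_def by linarith+
  have "2 powr (- real k) < 2 powr (log 2 (1 - t))" using k(1) by (intro powr_less_mono) auto
  then have "1 / 2 ^ k < 1 - t"
    using assms by (simp add: powr_minus powr_realpow divide_inverse)
  then have "assembly t \<le> real k" using assms by (intro assembly_le) auto
  then show ?thesis using k by simp
qed

section \<open>Dyadic points\<close>

text \<open>The denominator is positive for small \<open>h\<close> and tends to 0, since
  \<open>h * log 2 h\<close> does.\<close>

lemma inverse_mult_log_at_top:
  fixes a b c d :: real
  assumes "0 < a" "0 < c" "0 < d"
  shows "filterlim (\<lambda>h. 1 / (a * h * (b + c * (1 - log 2 (d * h))))) at_top (at_right 0)"
  using assms by real_asymp

text \<open>With \<open>a = assembly (2 ^ n * h)\<close>, determinant 1 makes the increment
  \<open>a / (q * (q + q' * a))\<close>. The logarithmic lower bound on \<open>a\<close> keeps this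
  far above order \<open>h\<close>.\<close>

lemma assembly_right_slope_at_top:
  assumes m: "m < 2 ^ n"
  defines "\<eta> \<equiv> real m / 2 ^ n"
  shows "filterlim (\<lambda>h. (assembly (\<eta> + h) - assembly \<eta>) / h) at_top (at_right 0)"
proof -
  define p p' q q' where "p = real (stern n m)" and "p' = real (stern n (Suc m))"
    and "q = real (stern n (2 ^ n - m))" and "q' = real (stern n (2 ^ n - Suc m))"
  have q: "0 < q" "0 \<le> q'" using m stern_pos by (simp_all add: q_def q'_def)
  have det: "p' * q = p * q' + 1" using stern_det_real[OF m] by (simp add: p_def p'_def q_def q'_def)
  have \<eta>: "assembly \<eta> = p / q" using assembly_dyadic[OF m] by (simp add: \<eta>_def p_def q_def)
  show ?thesis
  proof (rule filterlim_at_top_mono)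
    show "filterlim (\<lambda>h. 1 / (q * h * (q' + q * (1 - log 2 (2 ^ n * h))))) at_top (at_right 0)"
      using q by (intro inverse_mult_log_at_top) auto
    have "\<forall>\<^sub>F h in at_right 0. h \<in> {0<..<1 / 2 ^ n :: real}"
      by (intro eventually_at_right_real) simp
    then show "\<forall>\<^sub>F h in at_right 0. 1 / (q * h * (q' + q * (1 - log 2 (2 ^ n * h))))
        \<le> (assembly (\<eta> + h) - assembly \<eta>) / h"
    proof eventually_elim
      case (elim h)
      define t where "t = 2 ^ n * h"
      define a where "a = assembly t"
      define l where "l = 1 - log 2 t"
      have t: "0 < t" "t < 1" using elim by (simp_all add: t_def field_simps)
      have h: "0 < h" using elim by simp
      have la: "1 \<le> l * a" using assembly_ge_log[OF t] by (simp add: a_def l_def)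
      have a0: "0 \<le> a" using assembly_nonneg t by (simp add: a_def)
      have l0: "0 < l" using t by (simp add: l_def less_trans[of _ 0])
      have a: "0 < a" using la l0 a0 by (cases "a = 0") auto
      have "\<eta> + h = (real m + t) / 2 ^ n" by (simp add: \<eta>_def t_def add_divide_distrib)
      then have "assembly (\<eta> + h) = (p + p' * a) / (q + q' * a)"
        using assembly_self_similar[OF m, of t] t by (simp add: p_def p'_def q_def q'_def a_def)
      moreover have den: "0 < q + q' * a" using q a by (simp add: add_pos_nonneg)
      ultimately have "assembly (\<eta> + h) - assembly \<eta> = ((p + p' * a) * q - p * (q + q' * a)) / ((q + q' * a) * q)"
        using q \<eta> by (simp add: diff_frac_eq)
      also have "(p + p' * a) * q - p * (q + q' * a) = (p' * q - p * q') * a"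
        by (simp add: algebra_simps)
      finally have diff: "assembly (\<eta> + h) - assembly \<eta> = a / ((q + q' * a) * q)"
        using det by simp
      have "q + q' * a \<le> a * (q' + q * l)"
        using mult_left_mono[OF la, of q] q by (simp add: algebra_simps)
      moreover have "0 < q' + q * l" using q l0 by (simp add: add_nonneg_pos)
      ultimately have "1 / (q' + q * l) \<le> a / (q + q' * a)"
        using den by (simp add: frac_le_eq divide_le_eq le_divide_eq field_simps)
      then have "1 / (q' + q * l) / (q * h) \<le> a / (q + q' * a) / (q * h)"
        using q h by (intro divide_right_mono) auto
      then show ?case
        unfolding diff by (simp add: l_def t_def mult_ac)
    qed
  qed
qed

text \<open>Here \<eta> is the right end of cell \<open>m\<close>. The increment is
  \<open>- 1 / (q' * (q + q' * a))\<close>, and \<open>a\<close> grows at most logarithmically as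
  \<open>t\<close> approaches 1.\<close>

lemma assembly_left_slope_at_top:
  assumes m: "Suc m < 2 ^ n"
  defines "\<eta> \<equiv> real (Suc m) / 2 ^ n"
  shows "filterlim (\<lambda>h. (assembly (\<eta> + h) - assembly \<eta>) / h) at_top (at_left 0)"
proof -
  define p p' q q' where "p = real (stern n m)" and "p' = real (stern n (Suc m))"
    and "q = real (stern n (2 ^ n - m))" and "q' = real (stern n (2 ^ n - Suc m))"
  have m': "m < 2 ^ n" using m by simp
  have q: "0 < q" "0 < q'" using m stern_pos by (simp_all add: q_def q'_def)
  have det: "p' * q = p * q' + 1" using stern_det_real[OF m'] by (simp add: p_def p'_def q_def q'_def)
  have \<eta>: "assembly \<eta> = p' / q'" using assembly_dyadic[OF m] by (simp add: \<eta>_def p'_def q'_def)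
  have "filterlim (\<lambda>h. (assembly (\<eta> + - h) - assembly \<eta>) / - h) at_top (at_right 0)"
  proof (rule filterlim_at_top_mono)
    show "filterlim (\<lambda>h. 1 / (q' * h * (q + q' * (1 - log 2 (2 ^ n * h))))) at_top (at_right 0)"
      using q by (intro inverse_mult_log_at_top) auto
    have "\<forall>\<^sub>F h in at_right 0. h \<in> {0<..<1 / 2 ^ n :: real}"
      by (intro eventually_at_right_real) simp
    then show "\<forall>\<^sub>F h in at_right 0. 1 / (q' * h * (q + q' * (1 - log 2 (2 ^ n * h))))
        \<le> (assembly (\<eta> + - h) - assembly \<eta>) / - h"
    proof eventually_elim
      case (elim h)
      define t where "t = 1 - 2 ^ n * h"
      define a where "a = assembly t"
      define l where "l = 1 - log 2 (1 - t)"
      have t: "0 < t" "t < 1" using elim by (simp_all add: t_def field_simps)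
      have h: "0 < h" using elim by simp
      have al: "a \<le> l" using assembly_le_log[OF t] by (simp add: a_def l_def)
      have a: "0 \<le> a" using assembly_nonneg t by (simp add: a_def)
      have "\<eta> + - h = (real m + t) / 2 ^ n" by (simp add: \<eta>_def t_def add_divide_distrib diff_divide_distrib)
      then have "assembly (\<eta> + - h) = (p + p' * a) / (q + q' * a)"
        using assembly_self_similar[OF m', of t] t by (simp add: p_def p'_def q_def q'_def a_def)
      moreover have den: "0 < q + q' * a" using q a by (simp add: add_pos_nonneg)
      ultimately have "assembly (\<eta> + - h) - assembly \<eta> = ((p + p' * a) * q' - p' * (q + q' * a)) / ((q + q' * a) * q')"
        using q \<eta> by (simp add: diff_frac_eq)
      also have "(p + p' * a) * q' - p' * (q + q' * a) = - (p' * q - p * q')"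
        by (simp add: algebra_simps)
      finally have diff: "assembly (\<eta> + - h) - assembly \<eta> = - (1 / ((q + q' * a) * q'))"
        using det by simp
      have "1 / (q + q' * l) \<le> 1 / (q + q' * a)"
        using den q al by (intro divide_left_mono) (auto intro!: mult_pos_pos intro: less_le_trans)
      then have "1 / (q + q' * l) / (q' * h) \<le> 1 / (q + q' * a) / (q' * h)"
        using q h by (intro divide_right_mono) auto
      then show ?case
        unfolding diff by (simp add: l_def t_def mult_ac)
    qed
  qed
  then show ?thesis by (simp add: at_left_minus filterlim_filtermap)
qed

section \<open>Rational points\<close>

text \<open>By the pigeonhole principle two of the residues \<open>2 ^ i * a\<close> modulo
  \<open>b\<close> coincide, so the corresponding multiples of \<open>x\<close> differ by an
  integer.\<close>

lemma rational_doubling_eventually_periodic: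
  fixes x :: real
  assumes "x \<in> \<rat>"
  obtains N L :: nat where "0 < L" "frac (2 ^ (N + L) * x) = frac (2 ^ N * x)"
proof -
  obtain a b :: int where x: "x = of_int a / of_int b" and b: "0 < b"
    using assms by (elim Rats_cases') auto
  let ?r = "\<lambda>i::nat. (2 ^ i * a) mod b"
  have "range ?r \<subseteq> {0..<b}" using b by auto
  then have "finite (range ?r)" using finite_subset by blast
  then have "\<not> inj ?r" using finite_imageD infinite_UNIV_nat by blast
  then obtain i j where ij: "i < j" "?r i = ?r j"
    unfolding inj_def by (metis linorder_neqE_nat)
  have "b dvd 2 ^ j * a - 2 ^ i * a" using ij(2) by (metis mod_eq_dvd_iff)
  then obtain c where c: "2 ^ j * a - 2 ^ i * a = b * c" by (elim dvdE)
  have "2 ^ j * x - 2 ^ i * x = of_int (2 ^ j * a - 2 ^ i * a) / of_int b"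
    by (simp add: x diff_divide_distrib)
  also have "\<dots> = of_int c" unfolding c using b by simp
  finally have "2 ^ j * x = 2 ^ i * x + of_int c" by simp
  then have "frac (2 ^ j * x) = frac (2 ^ i * x)" by (simp add: frac_def)
  then show thesis using that[of "j - i" i] ij(1) by simp
qed

text \<open>Differentiating the self-similarity of \<open>assembly\<close> at its fixed point \<open>t\<close> gives
  \<open>D / 2 ^ L = D / r\<^sup>2\<close>, where \<open>r = q + q' * assembly t\<close> is an eigenvalue of an integer
  matrix of determinant 1. If \<open>D \<noteq> 0\<close> then \<open>r\<^sup>2 = 2 ^ L\<close>, so that the square of the integral trace
  \<open>r + 1 / r\<close> is \<open>2 ^ L + 2 + 1 / 2 ^ L\<close>, which is absurd.\<close>

lemma assembly_deriv_zero_at_periodic: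
  assumes L: "0 < L" and k: "k < 2 ^ L" and t: "0 < t" "t < 1" and fix_t: "(real k + t) / 2 ^ L = t"
    and D: "(assembly has_real_derivative D) (at t)"
  shows "D = 0"
proof (rule ccontr)
  assume "D \<noteq> 0"
  define p p' q q' where "p = real (stern L k)" and "p' = real (stern L (Suc k))"
    and "q = real (stern L (2 ^ L - k))" and "q' = real (stern L (2 ^ L - Suc k))"
  define a where "a = assembly t"
  define r where "r = q + q' * a"
  have q: "0 < q" "0 \<le> q'" using k stern_pos by (simp_all add: q_def q'_def)
  have det: "p' * q = p * q' + 1" using stern_det_real[OF k] by (simp add: p_def p'_def q_def q'_def)
  have a: "0 \<le> a" using assembly_nonneg t by (simp add: a_def)
  have r: "0 < r" using q a by (simp add: r_def add_pos_nonneg)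
  have self: "assembly ((real k + x) / 2 ^ L) = (p + p' * assembly x) / (q + q' * assembly x)"
    if "x \<in> {0<..<1}" for x
    using assembly_self_similar[OF k, of x] that by (simp add: p_def p'_def q_def q'_def)
  have "((\<lambda>x. (p + p' * assembly x) / (q + q' * assembly x)) has_real_derivative
      (p' * D * r - (p + p' * a) * (q' * D)) / (r * r)) (at t)"
    using r by (auto intro!: derivative_eq_intros D simp: r_def a_def)
  also have "p' * D * r - (p + p' * a) * (q' * D) = (p' * q - p * q') * D"
    by (simp add: r_def algebra_simps)
  finally have "((\<lambda>x. (p + p' * assembly x) / (q + q' * assembly x)) has_real_derivative
      D / (r * r)) (at t)" using det by simp
  moreover have "((\<lambda>x. assembly ((real k + x) / 2 ^ L)) has_real_derivative D * (1 / 2 ^ L)) (at t)"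
    by (rule DERIV_chain2[where f = assembly]) (auto intro!: derivative_eq_intros simp: fix_t D)
  then have "((\<lambda>x. (p + p' * assembly x) / (q + q' * assembly x)) has_real_derivative D * (1 / 2 ^ L)) (at t)"
    by (rule has_field_derivative_transform_within_open[where S = "{0<..<1}"]) (use t self in auto)
  ultimately have "D / (r * r) = D * (1 / 2 ^ L)" by (rule DERIV_unique)
  then have r2: "r * r = 2 ^ L" using \<open>D \<noteq> 0\<close> r by (simp add: field_simps)
  \<comment> \<open>Since \<open>t\<close> is fixed, the vector \<open>(a, 1)\<close> is an
    eigenvector with eigenvalue \<open>r\<close>, so \<open>r\<close> is a root of the
    characteristic polynomial with trace \<open>p' + q\<close>.\<close>
  have "a = (p + p' * a) / r" using self[of t] t fix_t by (simp add: a_def r_def)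
  then have "a * r = p + p' * a" using r by (simp add: field_simps)
  then have "r * r + 1 = (p' + q) * r"
    using det unfolding r_def by algebra
  \<comment> \<open>Squaring removes \<open>r\<close>, which may be irrational, and leaves an
    equation in integers.\<close>
  then have "(2 ^ L + 1) ^ 2 = (p' + q) ^ 2 * (r * r)"
    unfolding r2 by (metis power2_eq_square power_mult_distrib r2)
  then have "real ((2 ^ L + 1) ^ 2) = real ((stern L (Suc k) + stern L (2 ^ L - k)) ^ 2 * 2 ^ L)"
    unfolding r2 by (simp add: p'_def q_def add.commute)
  then have "(2 ^ L + 1) ^ 2 = (stern L (Suc k) + stern L (2 ^ L - k)) ^ 2 * 2 ^ L"
    unfolding of_nat_eq_iff .
  \<comment> \<open>Parity decides: as \<open>L > 0\<close>, the left side is odd and the right side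
    even.\<close>
  moreover have "even ((2::nat) ^ L)" "odd (((2::nat) ^ L + 1) ^ 2)" using L by simp_all
  ultimately show False by simp
qed

lemma nat_floor_frac:
  fixes y :: real
  assumes "0 \<le> y"
  shows "real (nat \<lfloor>y\<rfloor>) + frac y = y"
  using assms by (simp add: frac_def)

text \<open>Multiplication by \<open>2 ^ N\<close> strips the preperiod and leads to a periodic
  \<open>t\<close>. Differentiability is carried from \<eta> to \<open>t\<close> by the inverse
  Moebius map, and the zero derivative back by the map itself.\<close>

lemma assembly_deriv_zero_at_rational:
  assumes \<eta>: "\<eta> \<in> rational_unit - dyadic_unit" and diff: "assembly differentiable (at \<eta>)"
  shows "(assembly has_real_derivative 0) (at \<eta>)"
proof -
  have \<eta>01: "0 < \<eta>" "\<eta> < 1" and rat: "\<eta> \<in> \<rat>" using \<eta> by (auto simp: rational_unit_def)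
  obtain N L where L: "0 < L" and per: "frac (2 ^ (N + L) * \<eta>) = frac (2 ^ N * \<eta>)"
    using rational_doubling_eventually_periodic[OF rat] by blast
  define t where "t = frac (2 ^ N * \<eta>)"
  define M where "M = nat \<lfloor>2 ^ N * \<eta>\<rfloor>"
  define k where "k = nat \<lfloor>2 ^ L * t\<rfloor>"
  have t01: "0 \<le> t" "t < 1" by (simp_all add: t_def frac_lt_1)
  have \<eta>_eq: "real M + t = 2 ^ N * \<eta>"
    unfolding M_def t_def using \<eta>01 by (intro nat_floor_frac) simp
  have M: "M < 2 ^ N"
  proof -
    have "2 ^ N * \<eta> < 2 ^ N" using \<eta>01 by simp
    then have "real M < 2 ^ N" using \<eta>_eq t01 by linarith
    then show ?thesis by simp
  qed
  have t_pos: "0 < t"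
  proof (rule ccontr)
    assume "\<not> 0 < t"
    then have eq: "\<eta> = real M / 2 ^ N" using \<eta>_eq t01 by (simp add: field_simps)
    then have "0 < M" using \<eta>01 by (cases "M = 0") auto
    \<comment> \<open>\<open>dyadic_unit\<close> demands a positive exponent;
      \<open>0 < M < 2 ^ N\<close> rules out \<open>N = 0\<close>.\<close>
    moreover from this have "0 < N" using M by (cases N) auto
    ultimately have "\<eta> \<in> dyadic_unit" using eq M unfolding dyadic_unit_def by fastforce
    then show False using \<eta> by simp
  qed
  \<comment> \<open>The two numbers differ by an integer, so periodicity makes \<open>t\<close> its
    own fractional part after multiplication by \<open>2 ^ L\<close>.\<close>
  have "2 ^ L * t = 2 ^ (N + L) * \<eta> - of_int (2 ^ L * \<lfloor>2 ^ N * \<eta>\<rfloor>)"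
    by (simp add: t_def frac_def power_add algebra_simps)
  moreover have "frac (y - of_int c) = frac y" for y :: real and c
    by (simp add: frac_def)
  ultimately have "frac (2 ^ L * t) = t"
    using per by (simp only: t_def)
  then have t_eq: "real k + t = 2 ^ L * t"
    unfolding k_def using nat_floor_frac[of "2 ^ L * t"] t01 by simp
  have k: "k < 2 ^ L"
  proof -
    have "2 ^ L * t < 2 ^ L" using t01 by simp
    then have "real k < 2 ^ L" using t_eq t_pos by linarith
    then show ?thesis by simp
  qed
  define p p' q q' where "p = real (stern N M)" and "p' = real (stern N (Suc M))"
    and "q = real (stern N (2 ^ N - M))" and "q' = real (stern N (2 ^ N - Suc M))"
  have q: "0 < q" "0 \<le> q'" using M stern_pos by (simp_all add: q_def q'_def)
  have det: "p' * q = p * q' + 1" using stern_det_real[OF M] by (simp add: p_def p'_def q_def q'_def)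
  have self: "assembly ((real M + x) / 2 ^ N) = (p + p' * assembly x) / (q + q' * assembly x)"
    if "x \<in> {0<..<1}" for x
    using assembly_self_similar[OF M, of x] that by (simp add: p_def p'_def q_def q'_def)
  have den: "0 < q + q' * assembly x" if "x \<in> {0<..<1}" for x
    using that q assembly_nonneg[of x] by (simp add: add_pos_nonneg)
  define G where "G x = assembly ((real M + x) / 2 ^ N)" for x
  \<comment> \<open>The inverse matrix has entries \<open>q\<close>, \<open>-p\<close>,
    \<open>-q'\<close>, \<open>p'\<close>. Its denominator is a reciprocal of a positive number,
    hence nonzero.\<close>
  have G_den: "p' - q' * G x = 1 / (q + q' * assembly x)" if "x \<in> {0<..<1}" for x
  proof -
    have "p' - q' * G x = (p' * (q + q' * assembly x) - q' * (p + p' * assembly x)) / (q + q' * assembly x)"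
      unfolding G_def self[OF that] using den[OF that] by (simp add: diff_divide_distrib)
    also have "p' * (q + q' * assembly x) - q' * (p + p' * assembly x) = 1"
      using det by (simp add: algebra_simps)
    finally show ?thesis .
  qed
  have inv: "(q * G x - p) / (p' - q' * G x) = assembly x" if "x \<in> {0<..<1}" for x
  proof -
    have "q * G x - p = (q * (p + p' * assembly x) - p * (q + q' * assembly x)) / (q + q' * assembly x)"
      unfolding G_def self[OF that] using den[OF that] by (simp add: diff_divide_distrib)
    also have "q * (p + p' * assembly x) - p * (q + q' * assembly x) = (p' * q - p * q') * assembly x"
      by (simp add: algebra_simps)
    finally show ?thesis unfolding G_den[OF that] using det den[OF that] by simp
  qed
  have \<eta>_t: "(real M + t) / 2 ^ N = \<eta>" using \<eta>_eq by simp
  obtain E where E: "(assembly has_real_derivative E) (at \<eta>)"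
    using diff real_differentiable_def by blast
  have "(G has_real_derivative E * (1 / 2 ^ N)) (at t)"
    unfolding G_def
    by (rule DERIV_chain2[where f = assembly]) (auto intro!: derivative_eq_intros simp: \<eta>_t E)
  then have "G differentiable (at t)" using real_differentiable_def by blast
  moreover have "p' - q' * G t \<noteq> 0"
    using G_den[of t] den[of t] t_pos t01 by simp
  ultimately have "(\<lambda>x. (q * G x - p) / (p' - q' * G x)) differentiable (at t)"
    by (intro derivative_intros)
  then obtain D where "((\<lambda>x. (q * G x - p) / (p' - q' * G x)) has_real_derivative D) (at t)"
    using real_differentiable_def by blast
  then have D: "(assembly has_real_derivative D) (at t)"
    by (rule has_field_derivative_transform_within_open[where S = "{0<..<1}"]) (use t_pos t01 inv in auto)
  have "D = 0"
    using assembly_deriv_zero_at_periodic[OF L k t_pos t01(2) _ D] t_eq by simp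
  with D have "((\<lambda>x. (p + p' * assembly x) / (q + q' * assembly x)) has_real_derivative 0) (at t)"
    using den[of t] t_pos t01 by (auto intro!: derivative_eq_intros)
  then have "((\<lambda>y. (p + p' * assembly (2 ^ N * y - real M)) / (q + q' * assembly (2 ^ N * y - real M)))
      has_real_derivative 0 * 2 ^ N) (at \<eta>)"
    by (intro DERIV_chain2[where f = "\<lambda>x. (p + p' * assembly x) / (q + q' * assembly x)"])
      (auto intro!: derivative_eq_intros simp: \<eta>_eq[symmetric])
  then have "(assembly has_real_derivative 0 * 2 ^ N) (at \<eta>)"
  \<comment> \<open>Only on the open cell around \<eta> does the composed expression equal
    \<open>assembly\<close>; \<open>t > 0\<close> places \<eta> in its interior.\<close>
  proof (rule has_field_derivative_transform_within_open[where S = "{real M / 2 ^ N<..<(real M + 1) / 2 ^ N}"])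
    show "\<eta> \<in> {real M / 2 ^ N<..<(real M + 1) / 2 ^ N}"
      unfolding \<eta>_t[symmetric] using t_pos t01 by (simp add: divide_strict_right_mono)
    fix y assume y: "y \<in> {real M / 2 ^ N<..<(real M + 1) / 2 ^ N}"
    then have "2 ^ N * y - real M \<in> {0<..<1}" by (simp add: field_simps)
    from self[OF this] show "(p + p' * assembly (2 ^ N * y - real M)) /
        (q + q' * assembly (2 ^ N * y - real M)) = assembly y" by simp
  qed simp
  then show ?thesis by simp
qed

theorem theorem8p4:
  shows "(\<forall>\<eta>\<in>dyadic_unit.
            filterlim (\<lambda>h. (assembly (\<eta> + h) - assembly \<eta>) / h) at_top (at_left 0) \<and>
            filterlim (\<lambda>h. (assembly (\<eta> + h) - assembly \<eta>) / h) at_top (at_right 0)) \<and>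
         (\<forall>\<eta>\<in>rational_unit - dyadic_unit.
            assembly differentiable (at \<eta>) \<longrightarrow> (assembly has_real_derivative 0) (at \<eta>))"
proof (intro conjI ballI impI)
  fix \<eta> assume "\<eta> \<in> dyadic_unit"
  then obtain m n :: nat where \<eta>: "\<eta> = real m / 2 ^ n" "1 \<le> m" "m \<le> 2 ^ n - 1"
    by (auto simp: dyadic_unit_def)
  then have m: "m < 2 ^ n" by (metis Suc_pred' le_imp_less_Suc pos2 zero_less_power)
  \<comment> \<open>As \<open>m\<close> is positive, \<eta> is the right end of cell
    \<open>k\<close>, the form used for the left slope.\<close>
  obtain k where k: "m = Suc k" using \<eta>(2) by (cases m) auto
  show "filterlim (\<lambda>h. (assembly (\<eta> + h) - assembly \<eta>) / h) at_top (at_left 0)"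
    unfolding \<eta>(1) k using m k by (intro assembly_left_slope_at_top) simp
  show "filterlim (\<lambda>h. (assembly (\<eta> + h) - assembly \<eta>) / h) at_top (at_right 0)"
    unfolding \<eta>(1) using m by (rule assembly_right_slope_at_top)
qed (simp add: assembly_deriv_zero_at_rational)

end
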